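(* Let $C$ be a nonempty closed convex subset of a Banach space $X$, let $T:C\to C$ be a contraction mapping with contraction constant $\theta\in(0,1)$, and let $\widetilde{T}:C\to C$ be an approximate operator for $T$ with fixed $\varepsilon>0$, i.e. $\|Tx-\widetilde{T}x\|\le\varepsilon$ for all $x\in C$. Let $\{\alpha_n\}_{n=0}^{\infty}$ and $\{\beta_n\}_{n=0}^{\infty}$ be real sequences in $[0,1]$ satisfying (i) $\frac12\le\alpha_n\beta_n$ for all $n\in\mathbb{N}$ and (ii) $\sum_{n=0}^{\infty}\alpha_n\beta_n=\infty$. Let $\{x_n\}_{n=0}^{\infty}$ be generated from $x_0\in C$ by $$z_n=(1-\beta_n)x_n+\beta_nTx_n,\qquad y_n=T\big((1-\alpha_n)Tx_n+\alpha_nTz_n\big),\qquad x_{n+1}=Ty_n\qquad(n\ge 0),$$ and let $\{\widetilde{x}_n\}_{n=0}^{\infty}$ be generated from $\widetilde{x}_0\in C$ by $$\widetilde{z}_n=(1-\beta_n)\widetilde{x}_n+\beta_n\widetilde{T}\widetilde{x}_n,\qquad \widetilde{y}_n=\widetilde{T}\big((1-\alpha_n)\widetilde{T}\widetilde{x}_n+\alpha_n\widetilde{T}\widetilde{z}_n\big),\qquad \widetilde{x}_{n+1}=\widetilde{T}\widetilde{y}_n\qquad(n\ge 0).$$ If $Tp=p$ and $\widetilde{T}\widetilde{p}=\widetilde{p}$ are such that $\lim_{n\to\infty}\widetilde{x}_n=\widetilde{p}$, then $$\|p-\widetilde{p}\|\le\frac{7\varepsilon}{1-\theta}.$$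
   Context: Here $\mathbb{N}=\{0,1,2,\dots\}$. A mapping $T:C\to C$ is a contraction with constant $\theta\in(0,1)$ if $\|Tx-Ty\|\le\theta\|x-y\|$ for all $x,y\in C$. *)

theory Defs
  imports "HOL-Analysis.Analysis"
begin

text \<open>
  Maps on a subset \<open>C\<close> are total functions on the ambient type; only their values on \<open>C\<close> matter.
\<close>

definition contraction_map :: "real \<Rightarrow> 'a::real_normed_vector set \<Rightarrow> ('a \<Rightarrow> 'a) \<Rightarrow> bool" where
  "contraction_map \<theta> C T \<longleftrightarrow>
     0 < \<theta> \<and> \<theta> < 1 \<and> T \<in> C \<rightarrow> C \<and>
     (\<forall>x\<in>C. \<forall>y\<in>C. norm (T x - T y) \<le> \<theta> * norm (x - y))"

definition approximate_operator ::
    "real \<Rightarrow> 'a::real_normed_vector set \<Rightarrow> ('a \<Rightarrow> 'a) \<Rightarrow> ('a \<Rightarrow> 'a) \<Rightarrow> bool" where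
  "approximate_operator \<epsilon> C T T' \<longleftrightarrow>
     0 < \<epsilon> \<and> T' \<in> C \<rightarrow> C \<and> (\<forall>x\<in>C. norm (T x - T' x) \<le> \<epsilon>)"

end

theory Submission
  imports Defs
begin

text \<open>
  At its own fixed point \<open>p'\<close>, the operator \<open>T'\<close> differs from \<open>T\<close> by at most \<open>\<epsilon>\<close>, so \<open>T\<close> displaces
  \<open>p'\<close> by at most \<open>\<epsilon>\<close>. A contraction turns a small displacement of a point into closeness to the
  fixed point (the a posteriori estimate of Banach's fixed point theorem), which gives
  \<open>norm (p - p') \<le> \<epsilon> / (1 - \<theta>)\<close>.
\<close>

text \<open>
  By the triangle inequality through \<open>T q\<close>, the distance \<open>d\<close> from \<open>q\<close> to the fixed point
  satisfies \<open>d \<le> \<theta> * d + norm (T q - q)\<close>; solve for \<open>d\<close>.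
\<close>
lemma contraction_map_fixed_point_dist_le:
  assumes "contraction_map \<theta> C T" and "p \<in> C" and "T p = p" and "q \<in> C"
  shows "norm (p - q) \<le> norm (T q - q) / (1 - \<theta>)"
proof -
  have "\<theta> < 1" and "norm (T p - T q) \<le> \<theta> * norm (p - q)"
    using assms by (auto simp: contraction_map_def)
  moreover have "norm (p - q) \<le> norm (T p - T q) + norm (T q - q)"
    using norm_triangle_ineq[of "T p - T q" "T q - q"] \<open>T p = p\<close> by simp
  ultimately show ?thesis
    by (simp add: field_simps)
qed

theorem theorem3p5:
  fixes C :: "'a::banach set"
    and T T' :: "'a \<Rightarrow> 'a"
    and \<theta> \<epsilon> :: real
    and \<alpha> \<beta> :: "nat \<Rightarrow> real"
    and x y z x' y' z' :: "nat \<Rightarrow> 'a"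
    and p p' :: 'a
  assumes "C \<noteq> {}" and "closed C" and "convex C"
    and "contraction_map \<theta> C T"
    and "approximate_operator \<epsilon> C T T'"
    and "\<And>n. \<alpha> n \<in> {0..1}" and "\<And>n. \<beta> n \<in> {0..1}"
    and "\<And>n. 1 / 2 \<le> \<alpha> n * \<beta> n"
    and "filterlim (\<lambda>N. \<Sum>n\<le>N. \<alpha> n * \<beta> n) at_top sequentially"
    and "x 0 \<in> C"
    and "\<And>n. z n = (1 - \<beta> n) *\<^sub>R x n + \<beta> n *\<^sub>R T (x n)"
    and "\<And>n. y n = T ((1 - \<alpha> n) *\<^sub>R T (x n) + \<alpha> n *\<^sub>R T (z n))"
    and "\<And>n. x (Suc n) = T (y n)"
    and "x' 0 \<in> C"
    and "\<And>n. z' n = (1 - \<beta> n) *\<^sub>R x' n + \<beta> n *\<^sub>R T' (x' n)"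
    and "\<And>n. y' n = T' ((1 - \<alpha> n) *\<^sub>R T' (x' n) + \<alpha> n *\<^sub>R T' (z' n))"
    and "\<And>n. x' (Suc n) = T' (y' n)"
    and "p \<in> C" and "T p = p"
    and "p' \<in> C" and "T' p' = p'"
    and "x' \<longlonglongrightarrow> p'"
  shows "norm (p - p') \<le> 7 * \<epsilon> / (1 - \<theta>)"
proof -
  have "\<theta> < 1"
    using assms(4) by (simp add: contraction_map_def)
  have "0 < \<epsilon>" and "norm (T p' - p') \<le> \<epsilon>"
    using assms(5) \<open>p' \<in> C\<close> \<open>T' p' = p'\<close> by (force simp: approximate_operator_def)+
  have "norm (p - p') \<le> norm (T p' - p') / (1 - \<theta>)"
    using assms(4) \<open>p \<in> C\<close> \<open>T p = p\<close> \<open>p' \<in> C\<close>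
    by (rule contraction_map_fixed_point_dist_le)
  also have "\<dots> \<le> 7 * \<epsilon> / (1 - \<theta>)"
    using \<open>\<theta> < 1\<close> \<open>0 < \<epsilon>\<close> \<open>norm (T p' - p') \<le> \<epsilon>\<close> by (intro divide_right_mono) auto
  finally show ?thesis .
qed

end
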